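(* Let $\mathcal H$, $\mathcal V$, $\mathcal A$, $\mathcal B$, $f$, $\Psi_t$, $\Lambda$ satisfy the Dynamics Assumption described in the context, fix $h>0$, $\gamma>0$ and an integer $K\ge 1$, and write $\Psi=\Psi_h$. Let $\beta\in\mathbb R$ be a constant such that $|\Psi_t(v_0)-\Psi_t(w_0)|\le e^{\beta t}|v_0-w_0|$ for all $t>0$, $v_0\in\Lambda$, $w_0\in\mathcal H$ (such a constant exists under the Dynamics Assumption). Let the signal satisfy $u_{j+1}=\Psi(u_j)$ for $j\ge 0$ with $u_0\sim N(m_0,C_0)$, let the observations be $$y_{j+1}=u_{j+1}+\gamma\,\xi_{j+1},\qquad j\ge 0,$$ and let the ensemble $\{v_j^{(k)}\}_{k=1}^K$, $j\ge 0$, be generated by the perturbed-observation ensemble Kalman filter: for $j\ge0$ and $k=1,\dots,K$, $$\Bigl(I+\tfrac1{\gamma^2}\widehat C_{j+1}\Bigr)v_{j+1}^{(k)}=\Psi(v_j^{(k)})+\tfrac1{\gamma^2}\widehat C_{j+1}\,y_{j+1}^{(k)},\qquad y_{j+1}^{(k)}=y_{j+1}+\gamma\,\xi_{j+1}^{(k)},$$ $$\bar v_{j+1}=\frac1K\sum_{k=1}^K\Psi(v_j^{(k)}),\qquad \widehat C_{j+1}=\frac1K\sum_{k=1}^K\bigl(\Psi(v_j^{(k)})-\bar v_{j+1}\bigr)\otimes\bigl(\Psi(v_j^{(k)})-\bar v_{j+1}\bigr).$$ Set $e_j^{(k)}=v_j^{(k)}-u_j$. Then for every $j\ge 1$ and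 every $k\in\{1,\dots,K\}$, $$\mathbf E|e_j^{(k)}|^2\le e^{2\beta hj}\,\mathbf E|e_0^{(k)}|^2+2K\gamma^2\,\frac{e^{2\beta hj}-1}{e^{2\beta h}-1},$$ where, if $\beta=0$, the last fraction is read as $j$.
   Context: $\mathcal H$ is a separable real Hilbert space with norm $|\cdot|$ and inner product $\langle\cdot,\cdot\rangle$. For $a,b\in\mathcal H$, $a\otimes b$ is the rank-one operator $(a\otimes b)w=\langle b,w\rangle a$. Dynamics Assumption. $\mathcal V$ is a Banach space with norm $\|\cdot\|$, continuously embedded in $\mathcal H$. The evolution equation is $$\frac{du}{dt}+\mathcal Au+\mathcal B(u,u)=f,$$ where $\mathcal A$ is an unbounded linear operator on $\mathcal H$ with $\langle\mathcal Au,u\rangle\ge\lambda\|u\|^2$ for some $\lambda>0$ (for $u$ where the left side is defined); $\mathcal B:\mathcal V\times\mathcal V\to\mathcal H$ is symmetric bilinear with $\langle\mathcal B(u,u),u\rangle=0$ and $\langle\mathcal B(u,v),v\rangle\le c\|u\|\,\|v\|\,|v|$ for all $u,v$ (where these make sense), $c>0$ depending only on $\mathcal B$; and $f:\mathbb R_+\to\mathcal H$. The equation has a unique weak solution for every $u(0)\in\mathcal H$ and generates a one-parameter semigroup $\Psi_t:\mathcal V\to\mathcal V$ which extends to act on $\mathcal H$ (so $\Psi_t:\mathcal H\to\mathcal H$ is the time-$t$ solution map). There is a global attractor $\Lambda\subset\mathcal V$ for the dynamics and a constant $R>0$ such that $\sup_{t\ge0}\|u(t)\|\le R$ for every initial condition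 $u(0)\in\Lambda$. Noise and initial data. $\{\xi_j\}_{j\ge1}$ and $\{\xi_j^{(k)}\}_{j\ge1}$, $k=1,\dots,K$, are mutually independent i.i.d. sequences of standard Gaussian white noises $N(0,I)$ on $\mathcal H$. $N(m_0,C_0)$ is a Gaussian distribution on $\mathcal H$ with mean $m_0$ and covariance $C_0$; the signal's initial state $u_0$ has this distribution, and the initial ensemble members $v_0^{(k)}$ are independent draws from it. The initial data $u_0,v_0^{(1)},\dots,v_0^{(K)}$ are independent of each other and of all the noise sequences. $\mathbf E$ is expectation over all these random quantities.
   Formalization: The Lipschitz bound is assumed on Λ and also, almost surely, at the signal states u_j for time h, since it fails off Λ in general and the claim is then false; Ψ_t is assumed Borel measurable and the white noise to have a jointly measurable version. *)

theory Defs
  imports "HOL-Probability.Probability"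
begin

subsection \<open>The evolution equation\<close>

text \<open>
  The Banach space \<open>V\<close> is a type of its own, and \<open>emb\<close> is its continuous embedding into the
  Hilbert space \<open>H\<close>.  The unbounded operator \<open>A\<close> is given on a domain \<open>D\<close> inside \<open>V\<close> (its
  coercivity bound refers to the norm of \<open>V\<close>); only its values on \<open>D\<close> matter.

  Weak solutions of \<open>du/dt + A u + B(u,u) = f\<close> are tested against the domain of the adjoint of
  \<open>A\<close>: \<open>\<phi>\<close> belongs to it, with image \<open>\<psi>\<close>, iff \<open>\<langle>A x, \<phi>\<rangle> = \<langle>x, \<psi>\<rangle>\<close> for all \<open>x\<close> in \<open>D\<close>.  The
  function \<open>w\<close> is \<open>u\<close> viewed as a \<open>V\<close>-valued function, defined for almost every time.
\<close>

definition adjoint_pair ::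
    "('v \<Rightarrow> 'h::real_inner) \<Rightarrow> 'v set \<Rightarrow> ('v \<Rightarrow> 'h) \<Rightarrow> 'h \<Rightarrow> 'h \<Rightarrow> bool" where
  "adjoint_pair emb D A \<phi> \<psi> \<longleftrightarrow> (\<forall>x\<in>D. inner (A x) \<phi> = inner (emb x) \<psi>)"

definition weak_solution ::
    "('v::banach \<Rightarrow> 'h::{real_inner,banach,second_countable_topology}) \<Rightarrow> 'v set \<Rightarrow> ('v \<Rightarrow> 'h) \<Rightarrow>
     ('v \<Rightarrow> 'v \<Rightarrow> 'h) \<Rightarrow> (real \<Rightarrow> 'h) \<Rightarrow> (real \<Rightarrow> 'h) \<Rightarrow> bool" where
  "weak_solution emb D A B f u \<longleftrightarrow>
     continuous_on {0..} u \<and>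
     (\<exists>w :: real \<Rightarrow> 'v.
        (AE t in lborel. 0 \<le> t \<longrightarrow> u t = emb (w t)) \<and>
        (\<forall>T\<ge>0. set_integrable lborel {0..T} (\<lambda>s. (norm (w s))\<^sup>2)) \<and>
        (\<forall>\<phi> \<psi>. adjoint_pair emb D A \<phi> \<psi> \<longrightarrow>
           (\<forall>t\<ge>0.
              set_integrable lborel {0..t}
                (\<lambda>s. inner (f s) \<phi> - inner (u s) \<psi> - inner (B (w s) (w s)) \<phi>) \<and>
              inner (u t) \<phi> = inner (u 0) \<phi> +
                (LINT s:{0..t}|lborel.
                   inner (f s) \<phi> - inner (u s) \<psi> - inner (B (w s) (w s)) \<phi>))))"

definition global_attractor :: "(real \<Rightarrow> 'h::metric_space \<Rightarrow> 'h) \<Rightarrow> 'h set \<Rightarrow> bool" where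
  "global_attractor \<Psi> \<Lambda> \<longleftrightarrow>
     compact \<Lambda> \<and> \<Lambda> \<noteq> {} \<and> (\<forall>t\<ge>0. \<Psi> t ` \<Lambda> = \<Lambda>) \<and>
     (\<forall>S. bounded S \<longrightarrow> (\<forall>\<epsilon>>0. \<exists>T\<ge>0. \<forall>t\<ge>T. \<forall>x\<in>S. infdist (\<Psi> t x) \<Lambda> < \<epsilon>))"

locale dissipative_dynamics =
  fixes emb :: "'v::banach \<Rightarrow> 'h::{real_inner,banach,second_countable_topology}"
    and D :: "'v set"
    and A :: "'v \<Rightarrow> 'h"
    and B :: "'v \<Rightarrow> 'v \<Rightarrow> 'h"
    and f :: "real \<Rightarrow> 'h"
    and lam c R :: real
    and \<Psi> :: "real \<Rightarrow> 'h \<Rightarrow> 'h"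
    and \<Lambda> :: "'h set"
  assumes emb_bounded_linear: "bounded_linear emb"
    and emb_inj: "inj emb"
    and dom_subspace: "subspace D"
    and dom_dense: "closure (emb ` D) = UNIV"
    and A_add: "\<And>x y. x \<in> D \<Longrightarrow> y \<in> D \<Longrightarrow> A (x + y) = A x + A y"
    and A_scaleR: "\<And>a x. x \<in> D \<Longrightarrow> A (a *\<^sub>R x) = a *\<^sub>R A x"
    and lam_pos: "lam > 0"
    and A_coercive: "\<And>x. x \<in> D \<Longrightarrow> inner (A x) (emb x) \<ge> lam * (norm x)\<^sup>2"
    and B_bilinear: "bilinear B"
    and B_sym: "\<And>x y. B x y = B y x"
    and B_energy: "\<And>x. inner (B x x) (emb x) = 0"
    and c_pos: "c > 0"
    and B_bound: "\<And>x y. inner (B x y) (emb y) \<le> c * norm x * norm y * norm (emb y)"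
    and \<Psi>_zero: "\<And>x. \<Psi> 0 x = x"
    and \<Psi>_add: "\<And>s t x. s \<ge> 0 \<Longrightarrow> t \<ge> 0 \<Longrightarrow> \<Psi> (s + t) x = \<Psi> s (\<Psi> t x)"
    and \<Psi>_V: "\<And>t. t \<ge> 0 \<Longrightarrow> \<Psi> t ` range emb \<subseteq> range emb"
    and \<Psi>_solution: "\<And>x. weak_solution emb D A B f (\<lambda>t. \<Psi> t x)"
    and \<Psi>_unique: "\<And>u t. weak_solution emb D A B f u \<Longrightarrow> t \<ge> 0 \<Longrightarrow> u t = \<Psi> t (u 0)"
    \<comment> \<open>Makes states obtained by applying \<open>\<Psi> t\<close> to random variables random variables again.\<close>
    and \<Psi>_measurable: "\<And>t. t \<ge> 0 \<Longrightarrow> \<Psi> t \<in> borel_measurable borel"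
    and attractor: "global_attractor \<Psi> \<Lambda>"
    and attractor_V: "\<Lambda> \<subseteq> range emb"
    and R_pos: "R > 0"
    and attractor_bound: "\<And>x t. x \<in> \<Lambda> \<Longrightarrow> t \<ge> 0 \<Longrightarrow> \<exists>w. \<Psi> t x = emb w \<and> norm w \<le> R"


subsection \<open>Gaussian random elements\<close>

text \<open>Normal distribution with given mean and variance; a point mass if the variance is 0.\<close>

definition normal_law :: "real \<Rightarrow> real \<Rightarrow> real measure" where
  "normal_law \<mu> s =
     (if s = 0 then return borel \<mu>
      else density lborel (\<lambda>x. ennreal (normal_density \<mu> (sqrt s) x)))"

definition gaussian_rv ::
    "'w measure \<Rightarrow> 'h::{real_inner,banach,second_countable_topology} \<Rightarrow> ('h \<Rightarrow> 'h) \<Rightarrow>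
     ('w \<Rightarrow> 'h) \<Rightarrow> bool" where
  "gaussian_rv M m C X \<longleftrightarrow>
     X \<in> borel_measurable M \<and>
     bounded_linear C \<and> (\<forall>x y. inner (C x) y = inner x (C y)) \<and> (\<forall>x. 0 \<le> inner x (C x)) \<and>
     (\<forall>d. distr M borel (\<lambda>\<omega>. inner d (X \<omega>)) = normal_law (inner d m) (inner d (C d)))"

text \<open>
  In infinite dimensions white noise \<open>N(0,I)\<close> is not an \<open>H\<close>-valued random variable.  It is
  rendered as a generalized (cylindrical) random element: \<open>X \<omega> d\<close> stands for \<open>\<langle>d, X(\<omega>)\<rangle>\<close>.
  Almost sure linearity in \<open>d\<close> for each fixed choice of vectors, together with
  \<open>\<langle>d, X\<rangle> \<sim> N(0, |d|\<^sup>2)\<close>, says that \<open>X\<close> is a centred Gaussian process on \<open>H\<close> with covariance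
  \<open>\<langle>\<cdot>,\<cdot>\<rangle>\<close>.  Joint measurability selects a version which can be evaluated at a random \<open>d\<close>; it is
  required for the sigma-algebra generated by the noise itself, so that evaluation at a \<open>d\<close>
  independent of the noise has the expected law.  In finite dimensions a standard Gaussian
  vector \<open>Z\<close> gives the example \<open>X \<omega> d = \<langle>d, Z(\<omega>)\<rangle>\<close>.
\<close>

definition noise_algebra :: "'w measure \<Rightarrow> ('w \<Rightarrow> 'h \<Rightarrow> real) \<Rightarrow> 'w measure" where
  "noise_algebra M X = vimage_algebra (space M) X (Pi\<^sub>M UNIV (\<lambda>_. borel))"

definition white_noise ::
    "'w measure \<Rightarrow> ('w \<Rightarrow> 'h::{real_inner,banach,second_countable_topology} \<Rightarrow> real) \<Rightarrow> bool" where
  "white_noise M X \<longleftrightarrow>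
     (\<forall>d. (\<lambda>\<omega>. X \<omega> d) \<in> borel_measurable M) \<and>
     (\<forall>d. distr M borel (\<lambda>\<omega>. X \<omega> d) = normal_law 0 ((norm d)\<^sup>2)) \<and>
     (\<forall>a b d e. AE \<omega> in M. X \<omega> (a *\<^sub>R d + b *\<^sub>R e) = a * X \<omega> d + b * X \<omega> e) \<and>
     (\<lambda>(d, \<omega>). X \<omega> d) \<in> borel_measurable (borel \<Otimes>\<^sub>M noise_algebra M X)"

text \<open>The independent sources of randomness, and the events each of them determines.\<close>

datatype source = Signal | Member nat | Obs_Noise nat | Ens_Noise nat nat

definition source_events ::
    "'w measure \<Rightarrow> ('w \<Rightarrow> 'h::{real_inner,banach,second_countable_topology}) \<Rightarrow>
     (nat \<Rightarrow> 'w \<Rightarrow> 'h) \<Rightarrow> (nat \<Rightarrow> 'w \<Rightarrow> 'h \<Rightarrow> real) \<Rightarrow> (nat \<Rightarrow> nat \<Rightarrow> 'w \<Rightarrow> 'h \<Rightarrow> real) \<Rightarrow>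
     source \<Rightarrow> 'w set set" where
  "source_events M u0 v0 \<xi> \<eta> s =
     (case s of
        Signal \<Rightarrow> sets (vimage_algebra (space M) u0 borel)
      | Member k \<Rightarrow> sets (vimage_algebra (space M) (v0 k) borel)
      | Obs_Noise j \<Rightarrow> sets (noise_algebra M (\<xi> j))
      | Ens_Noise j k \<Rightarrow> sets (noise_algebra M (\<eta> j k)))"

definition sources :: "nat \<Rightarrow> source set" where
  "sources K = {Signal} \<union> Member ` {1..K} \<union> Obs_Noise ` {1..} \<union>
     {Ens_Noise j k | j k. 1 \<le> j \<and> k \<in> {1..K}}"


subsection \<open>Empirical covariance\<close>

definition outer :: "'h::real_inner \<Rightarrow> 'h \<Rightarrow> 'h \<Rightarrow> 'h" where
  "outer a b w = inner b w *\<^sub>R a"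

text \<open>
  The action of \<open>outer a b\<close> on a generalized element \<open>y\<close>, with \<open>y d\<close> standing for \<open>\<langle>d, y\<rangle>\<close>;
  if \<open>y = (\<lambda>d. inner d w)\<close>, this is \<open>outer a b w\<close>.
\<close>

definition outer_gen :: "'h::real_inner \<Rightarrow> 'h \<Rightarrow> ('h \<Rightarrow> real) \<Rightarrow> 'h" where
  "outer_gen a b y = y b *\<^sub>R a"

definition ens_mean :: "nat \<Rightarrow> (nat \<Rightarrow> 'h::real_inner) \<Rightarrow> 'h" where
  "ens_mean K x = (1 / real K) *\<^sub>R (\<Sum>k = 1..K. x k)"

definition emp_cov :: "nat \<Rightarrow> (nat \<Rightarrow> 'h::real_inner) \<Rightarrow> 'h \<Rightarrow> 'h" where
  "emp_cov K x w =
     (1 / real K) *\<^sub>R (\<Sum>k = 1..K. outer (x k - ens_mean K x) (x k - ens_mean K x) w)"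

definition emp_cov_gen :: "nat \<Rightarrow> (nat \<Rightarrow> 'h::real_inner) \<Rightarrow> ('h \<Rightarrow> real) \<Rightarrow> 'h" where
  "emp_cov_gen K x y =
     (1 / real K) *\<^sub>R (\<Sum>k = 1..K. outer_gen (x k - ens_mean K x) (x k - ens_mean K x) y)"

end

theory Submission
  imports Defs
begin

text \<open>
  With \<open>d\<^sub>i\<close> the deviation of the \<open>i\<close>-th forecast from the ensemble mean, \<open>\<alpha> = 1 / (K \<gamma>\<^sup>2)\<close> and
  \<open>S = (I + \<alpha> \<Sum>\<^sub>i d\<^sub>i \<otimes> d\<^sub>i)\<^sup>-\<^sup>1\<close>, subtracting the signal from the analysis equation gives
  \<open>e\<^sub>j\<^sub>+\<^sub>1 = S (\<Psi>(v\<^sub>j) - \<Psi>(u\<^sub>j)) + \<alpha> \<gamma> \<Sum>\<^sub>i (\<xi> + \<eta>)(d\<^sub>i) S d\<^sub>i\<close>.  The \<open>d\<^sub>i\<close>, and hence \<open>S\<close>, depend only on the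
  past, which is independent of the new noise; so the cross term has mean zero given the past.
  The first summand has norm at most \<open>e\<^bsup>\<beta>h\<^esup> |e\<^sub>j|\<close> because \<open>S\<close> is a contraction.  The conditional
  second moment of the second one is \<open>2 \<gamma>\<^sup>2\<close> times the trace of the square of an operator which
  lies between \<open>0\<close> and \<open>I\<close> and has rank at most \<open>K\<close>.
\<close>

subsection \<open>The regularized covariance operator\<close>

text \<open>With \<open>d\<close> the deviations from the ensemble mean and \<alpha> = 1/(K
  \<gamma>^2), this is the operator on the left of the analysis equation, identity plus scaled
  empirical covariance. The cutoff \<open>n\<close> permits induction over rank-one updates.\<close>

definition reg_op :: "real \<Rightarrow> (nat \<Rightarrow> 'h::real_inner) \<Rightarrow> nat \<Rightarrow> 'h \<Rightarrow> 'h" where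
  "reg_op \<alpha> d n x = x + \<alpha> *\<^sub>R (\<Sum>i = 1..n. inner (d i) x *\<^sub>R d i)"

text \<open>
  The inverse of \<open>reg_op\<close>, built from rank-one updates by the Sherman-Morrison formula so that its
  measurable dependence on \<open>d\<close> is visible.
\<close>

fun reg_inv :: "real \<Rightarrow> (nat \<Rightarrow> 'h::real_inner) \<Rightarrow> nat \<Rightarrow> 'h \<Rightarrow> 'h" where
  "reg_inv \<alpha> d 0 b = b"
| "reg_inv \<alpha> d (Suc n) b = reg_inv \<alpha> d n b -
     (\<alpha> * (inner (d (Suc n)) (reg_inv \<alpha> d n b) /
       (1 + \<alpha> * inner (d (Suc n)) (reg_inv \<alpha> d n (d (Suc n)))))) *\<^sub>R reg_inv \<alpha> d n (d (Suc n))"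

lemma linear_reg_op: "linear (reg_op \<alpha> d n)"
  by (rule linearI)
    (simp_all add: reg_op_def inner_add_right scaleR_add_left sum.distrib scaleR_add_right
      scaleR_sum_right mult_ac)

lemma inner_reg_op: "inner x (reg_op \<alpha> d n y) = inner x y + \<alpha> * (\<Sum>i = 1..n. inner (d i) x * inner (d i) y)"
  by (simp add: reg_op_def inner_add_right inner_sum_right inner_commute mult_ac)

text \<open>The rank-one terms are nonnegative in the pairing with \<open>x\<close>, and
  Cauchy-Schwarz does the rest. For the inverse this is the contraction property.\<close>

lemma norm_le_reg_op:
  assumes "\<alpha> \<ge> 0"
  shows "norm x \<le> norm (reg_op \<alpha> d n x)"
proof (cases "x = 0")
  case False
  have "(norm x)\<^sup>2 \<le> inner x (reg_op \<alpha> d n x)"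
    using assms by (simp add: inner_reg_op power2_norm_eq_inner sum_nonneg)
  also have "\<dots> \<le> norm x * norm (reg_op \<alpha> d n x)"
    by (rule norm_cauchy_schwarz)
  finally show ?thesis
    using False by (simp add: power2_eq_square)
qed simp

lemma reg_op_inject:
  assumes "\<alpha> \<ge> 0" "reg_op \<alpha> d n x = reg_op \<alpha> d n y"
  shows "x = y"
  using norm_le_reg_op[OF assms(1), of "x - y" d n] assms(2)
  by (simp add: linear_diff[OF linear_reg_op])

text \<open>Together with \<open>reg_op_inject\<close> this right-inverse property identifies every
  solution of the analysis equation. The induction keeps \<open>b\<close> general, since a rank-one
  update also inverts on the new vector.\<close>

lemma reg_op_reg_inv:
  assumes "\<alpha> \<ge> 0"
  shows "reg_op \<alpha> d n (reg_inv \<alpha> d n b) = b"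
proof (induction n arbitrary: b)
  case 0
  then show ?case by (simp add: reg_op_def)
next
  case (Suc n)
  define x where "x = reg_inv \<alpha> d n b"
  define e where "e = d (Suc n)"
  define w where "w = reg_inv \<alpha> d n e"
  define s where "s = inner e x / (1 + \<alpha> * inner e w)"
  \<comment> \<open>By induction \<open>reg_op\<close> sends \<open>w\<close> to \<open>e\<close>,
    so positivity of the operator makes the Sherman-Morrison denominator at least 1.\<close>
  have "inner w (reg_op \<alpha> d n w) \<ge> 0"
    using assms by (simp add: inner_reg_op sum_nonneg)
  then have "inner e w \<ge> 0"
    by (simp add: w_def Suc.IH inner_commute)
  then have "1 + \<alpha> * inner e w > 0"
    using assms by (simp add: add_pos_nonneg)
  then have s: "inner e x = s * (1 + \<alpha> * inner e w)"
    by (simp add: s_def)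
  have "reg_op \<alpha> d (Suc n) y = reg_op \<alpha> d n y + (\<alpha> * inner e y) *\<^sub>R e" for y
    by (simp add: reg_op_def e_def scaleR_add_right)
  moreover have "reg_op \<alpha> d n (x - (\<alpha> * s) *\<^sub>R w) = b - (\<alpha> * s) *\<^sub>R e"
    by (simp add: linear_diff[OF linear_reg_op] linear_scale[OF linear_reg_op] x_def w_def Suc.IH)
  \<comment> \<open>This is what fixes \<open>s\<close>: the new rank-one term contributes \<alpha>
    s \<open>e\<close>, exactly the defect left by the correction along \<open>w\<close>.\<close>
  moreover have "inner e (x - (\<alpha> * s) *\<^sub>R w) = s"
    by (simp add: inner_diff_right s algebra_simps)
  ultimately have "reg_op \<alpha> d (Suc n) (x - (\<alpha> * s) *\<^sub>R w) = b"
    by simp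
  then show ?case
    by (simp add: x_def w_def s_def e_def)
qed

lemma borel_measurable_reg_inv:
  fixes d :: "nat \<Rightarrow> 'w \<Rightarrow> 'h::{real_inner,second_countable_topology}"
  assumes "\<And>i. i \<in> {1..n} \<Longrightarrow> d i \<in> borel_measurable N" "b \<in> borel_measurable N"
  shows "(\<lambda>\<omega>. reg_inv \<alpha> (\<lambda>i. d i \<omega>) n (b \<omega>)) \<in> borel_measurable N"
  using assms
proof (induction n arbitrary: b)
  case (Suc n)
  have [measurable]: "d (Suc n) \<in> borel_measurable N"
    using Suc.prems by simp
  have [measurable]: "(\<lambda>\<omega>. reg_inv \<alpha> (\<lambda>i. d i \<omega>) n (b \<omega>)) \<in> borel_measurable N"
    "(\<lambda>\<omega>. reg_inv \<alpha> (\<lambda>i. d i \<omega>) n (d (Suc n) \<omega>)) \<in> borel_measurable N"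
    using Suc.prems by (auto intro!: Suc.IH)
  show ?case by simp
qed simp

text \<open>
  With \<open>G\<close> the Gram matrix of \<open>d\<close> and \<open>m = G (I + \<alpha> G)\<^sup>-\<^sup>1\<close>, which is symmetric, the sum is
  \<open>\<alpha>\<^sup>2 tr (m\<^sup>2)\<close>; each row satisfies \<open>\<alpha> (m\<^sup>2)\<^sub>i\<^sub>i \<le> m\<^sub>i\<^sub>i\<close>, hence also \<open>\<alpha> m\<^sub>i\<^sub>i \<le> 1\<close>.
\<close>

lemma gram_trace_bound:
  fixes d g :: "nat \<Rightarrow> 'h::real_inner"
  assumes \<alpha>: "\<alpha> \<ge> 0" and g: "\<And>i. reg_op \<alpha> d n (g i) = d i"
  shows "\<alpha>\<^sup>2 * (\<Sum>i = 1..n. \<Sum>j = 1..n. inner (d i) (d j) * inner (g i) (g j)) \<le> real n"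
proof -
  define m where "m i j = inner (d i) (g j)" for i j
  define G where "G i j = inner (d i) (d j)" for i j
  \<comment> \<open>Pairing the equation for \<open>g i\<close> with \<open>g j\<close> exhibits
    \<open>m\<close> as a sum of symmetric expressions, which yields \<open>m_sym\<close>
    below.\<close>
  have m: "m i j = inner (g i) (g j) + \<alpha> * (\<Sum>l = 1..n. m l i * m l j)" for i j
    using inner_reg_op[of "g j" \<alpha> d n "g i"]
    by (simp add: g m_def inner_commute mult_ac)
  then have gg: "inner (g i) (g j) = m i j - \<alpha> * (\<Sum>l = 1..n. m l i * m l j)" for i j
    by (metis add_diff_cancel_right')
  have m_sym: "m i j = m j i" for i j
    using m[of i j] m[of j i] by (simp only: inner_commute mult.commute)
  have G: "G i j - \<alpha> * (\<Sum>l = 1..n. G i l * m l j) = m i j" for i j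
    using inner_reg_op[of "d i" \<alpha> d n "g j"]
    by (simp add: g m_def G_def inner_commute mult_ac)
  \<comment> \<open>In matrix form, with \<Gamma> the Gram matrix of \<open>g\<close>: tr(G
    \<Gamma>) = tr(G (m - \<alpha> m^2)) = tr((G - \<alpha> G m) m) = tr(m^2). Swapping two sums
    brings \<open>G\<close> next to \<open>m\<close>.\<close>
  have "(\<Sum>i = 1..n. \<Sum>j = 1..n. G i j * inner (g i) (g j)) =
      (\<Sum>i = 1..n. \<Sum>j = 1..n. G i j * (m i j - \<alpha> * (\<Sum>l = 1..n. m l i * m l j)))"
    by (simp add: gg)
  also have "\<dots> = (\<Sum>i = 1..n. (\<Sum>j = 1..n. G i j * m i j) -
      (\<Sum>j = 1..n. \<Sum>l = 1..n. \<alpha> * G i j * m l i * m l j))"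
    by (simp add: right_diff_distrib sum_subtractf sum_distrib_left mult_ac)
  also have "\<dots> = (\<Sum>i = 1..n. (\<Sum>j = 1..n. G i j * m i j) -
      (\<Sum>l = 1..n. \<Sum>j = 1..n. \<alpha> * G i j * m l i * m l j))"
    by (subst (2) sum.swap) simp
  also have "\<dots> = (\<Sum>i = 1..n. \<Sum>l = 1..n. (G i l - \<alpha> * (\<Sum>j = 1..n. G i j * m j l)) * m i l)"
    by (simp add: left_diff_distrib right_diff_distrib sum_subtractf sum_distrib_left sum_distrib_right mult_ac m_sym)
  also have "\<dots> = (\<Sum>i = 1..n. \<Sum>l = 1..n. (m i l)\<^sup>2)"
    by (simp only: G power2_eq_square)
  finally have eq: "(\<Sum>i = 1..n. \<Sum>j = 1..n. G i j * inner (g i) (g j)) =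
    (\<Sum>i = 1..n. \<Sum>l = 1..n. (m i l)\<^sup>2)" .
  have row: "\<alpha>\<^sup>2 * (\<Sum>l = 1..n. (m i l)\<^sup>2) \<le> 1" if "i \<in> {1..n}" for i
  proof -
    have 1: "\<alpha> * (\<Sum>l = 1..n. (m i l)\<^sup>2) \<le> m i i"
    proof -
      have "(m i l)\<^sup>2 = m l i * m l i" for l
        by (metis m_sym power2_eq_square)
      then show ?thesis
        using inner_ge_zero[of "g i"] gg[of i i] by simp
    qed
    \<comment> \<open>The diagonal entry is one of the squares in its row. With t = \<alpha>
      \<open>m i i\<close> this leads to t^2 \<le> t, which excludes t > 1.\<close>
    have 2: "(m i i)\<^sup>2 \<le> (\<Sum>l = 1..n. (m i l)\<^sup>2)"
      using that by (intro member_le_sum) auto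
    have 3: "\<alpha> * (\<alpha> * (\<Sum>l = 1..n. (m i l)\<^sup>2)) \<le> \<alpha> * m i i"
      using 1 \<alpha> by (rule mult_left_mono)
    have "\<alpha>\<^sup>2 * (m i i)\<^sup>2 \<le> \<alpha>\<^sup>2 * (\<Sum>l = 1..n. (m i l)\<^sup>2)"
      using 2 by (rule mult_left_mono) simp
    with 3 have "(\<alpha> * m i i) * (\<alpha> * m i i) \<le> \<alpha> * m i i"
      by (simp add: power2_eq_square mult_ac)
    then have "\<alpha> * m i i \<le> 1"
      by (metis linorder_not_less mult.right_neutral mult_less_cancel_left_pos order_less_trans
          zero_less_one)
    with 3 show ?thesis
      by (simp add: power2_eq_square mult_ac)
  qed
  have "\<alpha>\<^sup>2 * (\<Sum>i = 1..n. \<Sum>l = 1..n. (m i l)\<^sup>2) = (\<Sum>i = 1..n. \<alpha>\<^sup>2 * (\<Sum>l = 1..n. (m i l)\<^sup>2))"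
    by (rule sum_distrib_left)
  also have "\<dots> \<le> (\<Sum>i = 1..n. 1)"
    using row by (intro sum_mono)
  finally show ?thesis
    using eq by (simp add: G_def)
qed


subsection \<open>Independence and moments of the noise\<close>

text \<open>Serves the degenerate case of \<open>normal_law\<close>, a point mass without
  density.\<close>

lemma has_bochner_integral_return:
  fixes g :: "'a \<Rightarrow> 'b::{banach,second_countable_topology}"
  assumes [measurable]: "g \<in> borel_measurable N" and "x \<in> space N"
  shows "has_bochner_integral (return N x) g (g x)"
proof -
  interpret prob_space "return N x"
    by (rule prob_space_return) fact
  have "AE y in return N x. g y = g x"
    using assms(2) by (subst AE_return) auto
  then have "has_bochner_integral (return N x) g (g x) \<longleftrightarrow>
      has_bochner_integral (return N x) (\<lambda>_. g x) (g x)"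
    by (intro has_bochner_integral_cong_AE) auto
  then show ?thesis
    using prob_space by (simp add: has_bochner_integral_iff)
qed

lemma normal_law_moments:
  assumes X[measurable]: "X \<in> borel_measurable M" and law: "distr M borel X = normal_law 0 s"
    and s: "s \<ge> 0"
  shows "integrable M X" "integral\<^sup>L M X = 0"
    and "integrable M (\<lambda>\<omega>. (X \<omega>)\<^sup>2)" "(LINT \<omega>|M. (X \<omega>)\<^sup>2) = s"
proof -
  have "has_bochner_integral (normal_law 0 s) (\<lambda>x. x) 0 \<and>
      has_bochner_integral (normal_law 0 s) (\<lambda>x. x\<^sup>2) s"
  proof (cases "s = 0")
    case True
    then have law0: "normal_law 0 s = return borel 0"
      by (simp add: normal_law_def)
    have "has_bochner_integral (return borel (0::real)) (\<lambda>x. x) 0"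
      by (rule has_bochner_integral_return) simp_all
    moreover have "has_bochner_integral (return borel (0::real)) (\<lambda>x. x\<^sup>2) (0\<^sup>2)"
      by (rule has_bochner_integral_return) simp_all
    ultimately show ?thesis
      using True law0 by simp
  next
    case False
    then have \<sigma>: "sqrt s > 0"
      using s by simp
    have density: "has_bochner_integral (normal_law 0 s) g I"
      if "g \<in> borel_measurable lborel"
        "has_bochner_integral lborel (\<lambda>x. normal_density 0 (sqrt s) x * g x) I"
      for g :: "real \<Rightarrow> real" and I
      unfolding normal_law_def using that False
      by (auto intro!: has_bochner_integral_density)
    \<comment> \<open>The moment formulas concern orders 2k+1 and 2k; they are taken at k = 0 and k
      = 1.\<close>
    have "has_bochner_integral (normal_law 0 s) (\<lambda>x. x) 0"
      using normal_moment_odd[OF \<sigma>, of 0 0] by (intro density) simp_all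
    moreover have "has_bochner_integral (normal_law 0 s) (\<lambda>x. x\<^sup>2) s"
      using normal_moment_even[OF \<sigma>, of 0 1] s False by (intro density) simp_all
    ultimately show ?thesis ..
  qed
  then have "has_bochner_integral (distr M borel X) (\<lambda>x. x) 0"
      "has_bochner_integral (distr M borel X) (\<lambda>x. x\<^sup>2) s"
    by (simp_all add: law)
  then show "integrable M X" "integral\<^sup>L M X = 0"
      "integrable M (\<lambda>\<omega>. (X \<omega>)\<^sup>2)" "(LINT \<omega>|M. (X \<omega>)\<^sup>2) = s"
    by (simp_all add: has_bochner_integral_iff integrable_distr_eq integral_distr)
qed

text \<open>\<open>white_noise\<close> prescribes only one-dimensional laws, so the covariance comes
  from polarization. Almost sure linearity for the fixed pair \<open>d\<close>, \<open>e\<close>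
  suffices to identify \<open>P\<close> with the product.\<close>

lemma white_noise_moments:
  assumes "white_noise M X"
  shows "integrable M (\<lambda>\<omega>. X \<omega> d)" "(LINT \<omega>|M. X \<omega> d) = 0"
    and "integrable M (\<lambda>\<omega>. X \<omega> d * X \<omega> e)" "(LINT \<omega>|M. X \<omega> d * X \<omega> e) = inner d e"
proof -
  have meas[measurable]: "(\<lambda>\<omega>. X \<omega> d) \<in> borel_measurable M" for d
    using assms by (simp add: white_noise_def)
  have law: "distr M borel (\<lambda>\<omega>. X \<omega> d) = normal_law 0 ((norm d)\<^sup>2)" for d
    using assms by (simp add: white_noise_def)
  note moments = normal_law_moments[OF meas law zero_le_power2]
  show "integrable M (\<lambda>\<omega>. X \<omega> d)" "(LINT \<omega>|M. X \<omega> d) = 0"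
    by (fact moments)+
  define P where "P \<omega> = ((X \<omega> (d + e))\<^sup>2 - (X \<omega> d)\<^sup>2 - (X \<omega> e)\<^sup>2) / 2" for \<omega>
  have "AE \<omega> in M. X \<omega> (1 *\<^sub>R d + 1 *\<^sub>R e) = 1 * X \<omega> d + 1 * X \<omega> e"
    using assms unfolding white_noise_def by blast
  then have ae: "AE \<omega> in M. P \<omega> = X \<omega> d * X \<omega> e"
    by eventually_elim (simp add: P_def power2_eq_square algebra_simps)
  have "integrable M P"
    unfolding P_def using moments(3) by simp
  moreover have "integral\<^sup>L M P = ((norm (d + e))\<^sup>2 - (norm d)\<^sup>2 - (norm e)\<^sup>2) / 2"
    unfolding P_def using moments(3,4) by simp
  moreover have "\<dots> = inner d e"
    by (simp add: power2_norm_eq_inner inner_add inner_commute)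
  moreover have "P \<in> borel_measurable M"
    unfolding P_def by measurable
  ultimately show "integrable M (\<lambda>\<omega>. X \<omega> d * X \<omega> e)" "(LINT \<omega>|M. X \<omega> d * X \<omega> e) = inner d e"
    using integrable_cong_AE[OF _ _ ae] integral_cong_AE[OF _ _ ae] by auto
qed

text \<open>Freezing of the past without conditional expectations: the identity, viewed as a map
  into \<open>N1\<close> and into \<open>N2\<close>, gives two independent random elements, so the
  diagonal map has the product law and Tonelli applies.\<close>

lemma (in prob_space) nn_integral_decouple:
  assumes indep: "indep_set (sets N1) (sets N2)"
    and space: "space N1 = space M" "space N2 = space M"
    and \<phi>[measurable]: "case_prod \<phi> \<in> borel_measurable (N1 \<Otimes>\<^sub>M N2)"
  shows "(\<integral>\<^sup>+\<omega>. \<phi> \<omega> \<omega> \<partial>M) = (\<integral>\<^sup>+\<omega>. \<integral>\<^sup>+\<omega>'. \<phi> \<omega> \<omega>' \<partial>M \<partial>M)"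
proof -
  \<comment> \<open>Preimages under the identity are the events themselves, so independence of the
    two identity maps is independence of the two sigma-algebras.\<close>
  have id_vimage: "sigma_sets (space M) {(\<lambda>x. x) -` A \<inter> space M |A. A \<in> sets N} = sets N"
    if "space N = space M" for N :: "'a measure"
  proof -
    have "A \<inter> space M = A" if "A \<in> sets N" for A
      using sets.sets_into_space[OF that] \<open>space N = space M\<close> by auto
    then have "{(\<lambda>x. x) -` A \<inter> space M |A. A \<in> sets N} = sets N"
      by auto
    then show ?thesis
      using sets.sigma_sets_eq[of N] that by simp
  qed
  have id1[measurable]: "(\<lambda>x. x) \<in> measurable M N1" and id2[measurable]: "(\<lambda>x. x) \<in> measurable M N2"
    using indep_setD_ev1[OF indep] indep_setD_ev2[OF indep] space
    by (auto intro!: measurableI sets.Int)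
  have "indep_var N1 (\<lambda>x. x) N2 (\<lambda>x. x)"
    using indep unfolding indep_var_eq id_vimage[OF space(1)] id_vimage[OF space(2)] by simp
  then have eq: "distr M N1 (\<lambda>x. x) \<Otimes>\<^sub>M distr M N2 (\<lambda>x. x) = distr M (N1 \<Otimes>\<^sub>M N2) (\<lambda>x. (x, x))"
    by (simp add: indep_var_distribution_eq)
  interpret D1: prob_space "distr M N1 (\<lambda>x. x)" by (rule prob_space_distr) simp
  interpret D2: prob_space "distr M N2 (\<lambda>x. x)" by (rule prob_space_distr) simp
  have \<phi>': "case_prod \<phi> \<in> borel_measurable (distr M N1 (\<lambda>x. x) \<Otimes>\<^sub>M distr M N2 (\<lambda>x. x))"
    using \<phi> by (simp cong: measurable_cong_sets sets_pair_measure_cong)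
  have "(\<integral>\<^sup>+\<omega>. \<phi> \<omega> \<omega> \<partial>M) = (\<integral>\<^sup>+p. case_prod \<phi> p \<partial>distr M (N1 \<Otimes>\<^sub>M N2) (\<lambda>x. (x, x)))"
    by (subst nn_integral_distr) auto
  also have "\<dots> = (\<integral>\<^sup>+\<omega>. \<integral>\<^sup>+\<omega>'. \<phi> \<omega> \<omega>' \<partial>distr M N2 (\<lambda>x. x) \<partial>distr M N1 (\<lambda>x. x))"
    using D2.nn_integral_fst[OF \<phi>'] by (simp add: eq)
  also have "\<dots> = (\<integral>\<^sup>+\<omega>. \<integral>\<^sup>+\<omega>'. \<phi> \<omega> \<omega>' \<partial>distr M N2 (\<lambda>x. x) \<partial>M)"
    by (subst nn_integral_distr) (auto intro!: D2.borel_measurable_nn_integral simp: \<phi>')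
  also have "\<dots> = (\<integral>\<^sup>+\<omega>. \<integral>\<^sup>+\<omega>'. \<phi> \<omega> \<omega>' \<partial>M \<partial>M)"
    using space by (intro nn_integral_cong nn_integral_distr) auto
  finally show ?thesis .
qed

text \<open>Expand the square; the cross term with \<open>a\<close> is linear in the centred
  \<open>X i\<close>. Here \<open>a\<close> and \<open>b\<close> are constants, as they are once the
  past is frozen.\<close>

lemma (in prob_space) nn_integral_norm_add_noise:
  fixes a :: "'h::real_inner"
  assumes int: "\<And>i. i \<in> I \<Longrightarrow> integrable M (X i)" and mean: "\<And>i. i \<in> I \<Longrightarrow> expectation (X i) = 0"
    and int2: "\<And>i j. i \<in> I \<Longrightarrow> j \<in> I \<Longrightarrow> integrable M (\<lambda>\<omega>. X i \<omega> * X j \<omega>)"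
  shows "(\<integral>\<^sup>+\<omega>. ennreal ((norm (a + (\<Sum>i\<in>I. X i \<omega> *\<^sub>R b i)))\<^sup>2) \<partial>M) =
    ennreal ((norm a)\<^sup>2 + (\<Sum>i\<in>I. \<Sum>j\<in>I. expectation (\<lambda>\<omega>. X i \<omega> * X j \<omega>) * inner (b i) (b j)))"
proof -
  have eq: "(norm (a + (\<Sum>i\<in>I. X i \<omega> *\<^sub>R b i)))\<^sup>2 =
      (norm a)\<^sup>2 + 2 * (\<Sum>i\<in>I. X i \<omega> * inner a (b i)) +
        (\<Sum>i\<in>I. \<Sum>j\<in>I. X i \<omega> * X j \<omega> * inner (b i) (b j))" for \<omega>
  proof -
    define S where "S = (\<Sum>i\<in>I. X i \<omega> *\<^sub>R b i)"
    have "inner S S = (\<Sum>i\<in>I. \<Sum>j\<in>I. X i \<omega> * X j \<omega> * inner (b i) (b j))"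
      by (simp add: S_def inner_sum_left inner_sum_right sum_distrib_left mult_ac inner_commute)
    moreover have "inner a S = (\<Sum>i\<in>I. X i \<omega> * inner a (b i))"
      by (simp add: S_def inner_sum_right)
    ultimately show ?thesis
      by (simp add: S_def[symmetric] power2_norm_eq_inner inner_add inner_commute)
  qed
  have integrable: "integrable M (\<lambda>\<omega>. (norm (a + (\<Sum>i\<in>I. X i \<omega> *\<^sub>R b i)))\<^sup>2)"
    unfolding eq using int int2 by simp
  have "(\<integral>\<^sup>+\<omega>. ennreal ((norm (a + (\<Sum>i\<in>I. X i \<omega> *\<^sub>R b i)))\<^sup>2) \<partial>M) =
      ennreal (expectation (\<lambda>\<omega>. (norm (a + (\<Sum>i\<in>I. X i \<omega> *\<^sub>R b i)))\<^sup>2))"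
    by (rule nn_integral_eq_integral[OF integrable]) simp
  also have "expectation (\<lambda>\<omega>. (norm (a + (\<Sum>i\<in>I. X i \<omega> *\<^sub>R b i)))\<^sup>2) =
      (norm a)\<^sup>2 + (\<Sum>i\<in>I. \<Sum>j\<in>I. expectation (\<lambda>\<omega>. X i \<omega> * X j \<omega>) * inner (b i) (b j))"
    unfolding eq using int int2 mean by (simp add: prob_space)
  finally show ?thesis .
qed

text \<open>The mixed products are products of independent centred variables and integrate to zero,
  so the two identity covariances add. This is the origin of the factor 2 in the final
  bound.\<close>

lemma (in prob_space) white_noise_sum_moments:
  assumes X: "white_noise M X" and Y: "white_noise M Y"
    and indep: "indep_set (sets (noise_algebra M X)) (sets (noise_algebra M Y))"
  shows "integrable M (\<lambda>\<omega>. X \<omega> d + Y \<omega> d)" "expectation (\<lambda>\<omega>. X \<omega> d + Y \<omega> d) = 0"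
    and "integrable M (\<lambda>\<omega>. (X \<omega> d + Y \<omega> d) * (X \<omega> e + Y \<omega> e))"
      "expectation (\<lambda>\<omega>. (X \<omega> d + Y \<omega> d) * (X \<omega> e + Y \<omega> e)) = 2 * inner d e"
proof -
  note mX = white_noise_moments[OF X] and mY = white_noise_moments[OF Y]
  \<comment> \<open>Evaluation at a fixed vector is a coordinate of the process, so its events
    belong to the noise algebra.\<close>
  have eval: "sigma_sets (space M) {(\<lambda>\<omega>. Z \<omega> d) -` A \<inter> space M |A. A \<in> sets borel} \<subseteq>
      sets (noise_algebra M Z)" for Z :: "'a \<Rightarrow> 'b \<Rightarrow> real" and d
  proof -
    have "Z \<in> measurable (noise_algebra M Z) (Pi\<^sub>M UNIV (\<lambda>_. borel))"
      unfolding noise_algebra_def by (rule measurable_vimage_algebra1) (simp add: space_PiM)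
    from measurable_compose[OF this measurable_component_singleton[of d UNIV]]
    have "(\<lambda>\<omega>. Z \<omega> d) \<in> borel_measurable (noise_algebra M Z)"
      by simp
    then have "{(\<lambda>\<omega>. Z \<omega> d) -` A \<inter> space M |A. A \<in> sets borel} \<subseteq> sets (noise_algebra M Z)"
      by (auto simp: noise_algebra_def dest: measurable_sets)
    then show ?thesis
      using sets.sigma_sets_subset[of _ "noise_algebra M Z"] by (simp add: noise_algebra_def)
  qed
  have iv: "indep_var borel (\<lambda>\<omega>. X \<omega> d) borel (\<lambda>\<omega>. Y \<omega> e)" for d e
    unfolding indep_var_eq
  proof (intro conjI)
    show "indep_set (sigma_sets (space M) {(\<lambda>\<omega>. X \<omega> d) -` A \<inter> space M |A. A \<in> sets borel})
        (sigma_sets (space M) {(\<lambda>\<omega>. Y \<omega> e) -` A \<inter> space M |A. A \<in> sets borel})"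
      using indep eval[of X d] eval[of Y e] unfolding indep_sets2_eq by blast
  qed (use mX(1) mY(1) in auto)
  have iXY: "integrable M (\<lambda>\<omega>. X \<omega> d * Y \<omega> e)" for d e
    by (rule indep_var_integrable[OF iv mX(1) mY(1)])
  have eXY: "expectation (\<lambda>\<omega>. X \<omega> d * Y \<omega> e) = 0" for d e
    by (simp add: indep_var_lebesgue_integral[OF iv mX(1) mY(1)] mX)
  show "integrable M (\<lambda>\<omega>. X \<omega> d + Y \<omega> d)" "expectation (\<lambda>\<omega>. X \<omega> d + Y \<omega> d) = 0"
    by (simp_all add: mX mY)
  have "(X \<omega> d + Y \<omega> d) * (X \<omega> e + Y \<omega> e) =
      X \<omega> d * X \<omega> e + X \<omega> d * Y \<omega> e + X \<omega> e * Y \<omega> d + Y \<omega> d * Y \<omega> e" for \<omega>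
    by (simp add: algebra_simps)
  then show "integrable M (\<lambda>\<omega>. (X \<omega> d + Y \<omega> d) * (X \<omega> e + Y \<omega> e))"
      "expectation (\<lambda>\<omega>. (X \<omega> d + Y \<omega> d) * (X \<omega> e + Y \<omega> e)) = 2 * inner d e"
    by (simp_all add: mX mY iXY eXY)
qed

subsection \<open>Events determined by a set of sources\<close>

lemma Int_stable_source_events: "Int_stable (source_events M u0 v0 \<xi> \<eta> s)"
  by (cases s) (auto simp: source_events_def Int_stable_def)

text \<open>Encoded as a measure space that only carries a sigma-algebra, so that depending on the
  sources in \<open>J\<close> alone becomes measurability.\<close>

definition source_algebra where
  "source_algebra M u0 v0 \<xi> \<eta> J =
     sigma (space M) (\<Union>s\<in>J. source_events M u0 v0 \<xi> \<eta> s)"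

lemma source_events_space: "source_events M u0 v0 \<xi> \<eta> s \<subseteq> Pow (space M)"
  by (cases s) (simp_all add: source_events_def noise_algebra_def,
    (metis sets.space_closed space_vimage_algebra)+)

lemma space_source_algebra [simp]: "space (source_algebra M u0 v0 \<xi> \<eta> J) = space M"
  unfolding source_algebra_def using source_events_space[of M u0 v0 \<xi> \<eta>] by (intro space_measure_of) auto

lemma sets_source_algebra:
  "sets (source_algebra M u0 v0 \<xi> \<eta> J) =
    sigma_sets (space M) (\<Union>s\<in>J. source_events M u0 v0 \<xi> \<eta> s)"
  unfolding source_algebra_def using source_events_space[of M u0 v0 \<xi> \<eta>] by (intro sets_measure_of) auto

lemma source_algebra_mono:
  assumes "J \<subseteq> J'"
  shows "sets (source_algebra M u0 v0 \<xi> \<eta> J) \<subseteq> sets (source_algebra M u0 v0 \<xi> \<eta> J')"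
  unfolding sets_source_algebra using assms by (intro sigma_sets_mono') auto

lemma source_events_subset:
  assumes "s \<in> J"
  shows "source_events M u0 v0 \<xi> \<eta> s \<subseteq> sets (source_algebra M u0 v0 \<xi> \<eta> J)"
  unfolding sets_source_algebra using assms by auto

text \<open>Disjoint groups of independent, intersection-stable families generate independent
  sigma-algebras. The two groups are indexed by booleans, matching the definition of
  \<open>indep_set\<close>.\<close>

lemma (in prob_space) indep_source_algebra:
  assumes "indep_sets (source_events M u0 v0 \<xi> \<eta>) S" "J1 \<subseteq> S" "J2 \<subseteq> S" "J1 \<inter> J2 = {}"
  shows "indep_set (sets (source_algebra M u0 v0 \<xi> \<eta> J1)) (sets (source_algebra M u0 v0 \<xi> \<eta> J2))"
proof -
  have "indep_sets (\<lambda>b. sigma_sets (space M) (\<Union>s\<in>(if b then J1 else J2). source_events M u0 v0 \<xi> \<eta> s)) UNIV"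
  proof (rule indep_sets_collect_sigma)
    show "indep_sets (source_events M u0 v0 \<xi> \<eta>) (\<Union>b. if b then J1 else J2)"
      using assms(2,3) by (intro indep_sets_mono_index[OF _ assms(1)]) auto
    show "disjoint_family (\<lambda>b. if b then J1 else J2)"
      using assms(4) by (auto simp: disjoint_family_on_def)
  qed (rule Int_stable_source_events)
  then show ?thesis
    unfolding indep_set_def
    by (rule indep_sets_mono_sets) (simp add: sets_source_algebra split: bool.split)
qed

text \<open>Compose the jointly measurable evaluation with the pair of \<open>g\<close> and
  \<open>i\<close>. The separate map \<open>i\<close> lets the noise be sampled at one point while
  the vector depends on another, as on a product space.\<close>

lemma measurable_white_noise_eval:
  assumes "white_noise M X" "sets (noise_algebra M X) \<subseteq> sets N" "space N = space M"
    and g: "g \<in> borel_measurable L" and i: "i \<in> measurable L N"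
  shows "(\<lambda>\<omega>. X (i \<omega>) (g \<omega>)) \<in> borel_measurable L"
proof -
  have "(\<lambda>\<omega>. \<omega>) \<in> measurable N (noise_algebra M X)"
    using assms(2,3) by (auto simp: noise_algebra_def intro!: measurableI sets.Int)
  from measurable_compose[OF i this] g
  have "(\<lambda>\<omega>. (g \<omega>, i \<omega>)) \<in> measurable L (borel \<Otimes>\<^sub>M noise_algebra M X)"
    by measurable
  moreover have "(\<lambda>(d, \<omega>). X \<omega> d) \<in> borel_measurable (borel \<Otimes>\<^sub>M noise_algebra M X)"
    using assms(1) by (simp add: white_noise_def)
  ultimately show ?thesis
    using measurable_compose by fastforce
qed


subsection \<open>One step of the filter\<close>

text \<open>\<open>F\<close> plays the past and \<open>G\<close> the new noise. The equation is
  solved for \<open>e\<close>, the past is frozen and the noise integrated out; contraction bounds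
  the first term and \<open>gram_trace_bound\<close> the second.\<close>

lemma (in prob_space) nn_integral_reg_op_noise_le:
  fixes d :: "nat \<Rightarrow> 'a \<Rightarrow> 'h::{real_inner,banach,second_countable_topology}"
  assumes indep: "indep_set (sets F) (sets G)" and space: "space F = space M" "space G = space M"
    and d: "\<And>i. i \<in> {1..n} \<Longrightarrow> d i \<in> borel_measurable F" and a: "a \<in> borel_measurable F"
    and X: "white_noise M X" "sets (noise_algebra M X) \<subseteq> sets G"
    and Y: "white_noise M Y" "sets (noise_algebra M Y) \<subseteq> sets G"
    and indep_noise: "indep_set (sets (noise_algebra M X)) (sets (noise_algebra M Y))"
    and \<alpha>: "\<alpha> \<ge> 0"
    and eq: "\<And>\<omega>. \<omega> \<in> space M \<Longrightarrow> reg_op \<alpha> (\<lambda>i. d i \<omega>) n (e \<omega>) =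
        a \<omega> + (\<alpha> * \<gamma>) *\<^sub>R (\<Sum>i = 1..n. (X \<omega> (d i \<omega>) + Y \<omega> (d i \<omega>)) *\<^sub>R d i \<omega>)"
  shows "(\<integral>\<^sup>+\<omega>. ennreal ((norm (e \<omega>))\<^sup>2) \<partial>M) \<le>
    (\<integral>\<^sup>+\<omega>. ennreal ((norm (a \<omega>))\<^sup>2 + 2 * real n * \<gamma>\<^sup>2) \<partial>M)"
proof -
  define T where "T \<omega> = reg_inv \<alpha> (\<lambda>i. d i \<omega>) n" for \<omega>
  define b where "b i \<omega> = (\<alpha> * \<gamma>) *\<^sub>R T \<omega> (d i \<omega>)" for i \<omega>
  define Z where "Z \<omega> x = X \<omega> x + Y \<omega> x" for \<omega> x
  \<comment> \<open>The two roles of the sample point are separated: the first argument drives the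
    past, the second only the noise. On the diagonal this is the squared norm of
    \<open>e\<close>.\<close>
  define \<phi> where
    "\<phi> \<omega> \<omega>' = ennreal ((norm (T \<omega> (a \<omega>) + (\<Sum>i = 1..n. Z \<omega>' (d i \<omega>) *\<^sub>R b i \<omega>)))\<^sup>2)" for \<omega> \<omega>'
  have T: "reg_op \<alpha> (\<lambda>i. d i \<omega>) n (T \<omega> x) = x" for \<omega> x
    unfolding T_def by (rule reg_op_reg_inv[OF \<alpha>])
  have e: "e \<omega> = T \<omega> (a \<omega>) + (\<Sum>i = 1..n. Z \<omega> (d i \<omega>) *\<^sub>R b i \<omega>)" if "\<omega> \<in> space M" for \<omega>
  proof (rule reg_op_inject[OF \<alpha>])
    show "reg_op \<alpha> (\<lambda>i. d i \<omega>) n (e \<omega>) =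
        reg_op \<alpha> (\<lambda>i. d i \<omega>) n (T \<omega> (a \<omega>) + (\<Sum>i = 1..n. Z \<omega> (d i \<omega>) *\<^sub>R b i \<omega>))"
      using linear_reg_op[of \<alpha> "\<lambda>i. d i \<omega>" n]
      by (simp add: eq[OF that] linear_add linear_sum linear_scale b_def T Z_def
          scaleR_sum_right mult.commute)
  qed
  have T_meas: "(\<lambda>\<omega>. T \<omega> (x \<omega>)) \<in> borel_measurable F" if "x \<in> borel_measurable F" for x
    unfolding T_def using d that by (rule borel_measurable_reg_inv)
  have Z_meas: "(\<lambda>p. Z (snd p) (d i (fst p))) \<in> borel_measurable (F \<Otimes>\<^sub>M G)" if "i \<in> {1..n}" for i
    unfolding Z_def
    by (intro borel_measurable_add measurable_white_noise_eval[OF X space(2)]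
        measurable_white_noise_eval[OF Y space(2)] measurable_compose[OF measurable_fst d[OF that]]
        measurable_snd)
  have b_meas: "b i \<in> borel_measurable F" if "i \<in> {1..n}" for i
    unfolding b_def by (intro borel_measurable_scaleR borel_measurable_const T_meas d that)
  have \<phi>_meas: "case_prod \<phi> \<in> borel_measurable (F \<Otimes>\<^sub>M G)"
    unfolding \<phi>_def case_prod_beta
    by (intro measurable_compose[OF _ measurable_ennreal] borel_measurable_power
        measurable_compose[OF _ borel_measurable_norm] borel_measurable_add borel_measurable_sum borel_measurable_scaleR
        Z_meas measurable_compose[OF measurable_fst b_meas]
        measurable_compose[OF measurable_fst T_meas] a)
  have inner_bound: "(\<integral>\<^sup>+\<omega>'. \<phi> \<omega> \<omega>' \<partial>M) \<le> ennreal ((norm (a \<omega>))\<^sup>2 + 2 * real n * \<gamma>\<^sup>2)" for \<omega>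
  proof -
    note Z_moments = white_noise_sum_moments[OF X(1) Y(1) indep_noise, folded Z_def]
    have "(\<integral>\<^sup>+\<omega>'. \<phi> \<omega> \<omega>' \<partial>M) = ennreal ((norm (T \<omega> (a \<omega>)))\<^sup>2 + (\<Sum>i = 1..n. \<Sum>j = 1..n.
        2 * inner (d i \<omega>) (d j \<omega>) * inner (b i \<omega>) (b j \<omega>)))"
      unfolding \<phi>_def by (subst nn_integral_norm_add_noise) (simp_all add: Z_moments)
    \<comment> \<open>Extracting \<alpha> \<gamma> from each \<open>b\<close> leaves the double sum
      of \<open>gram_trace_bound\<close> with \<open>g i\<close> taken as the inverse applied to
      \<open>d i\<close>.\<close>
    also have "(\<Sum>i = 1..n. \<Sum>j = 1..n. 2 * inner (d i \<omega>) (d j \<omega>) * inner (b i \<omega>) (b j \<omega>)) =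
        2 * \<gamma>\<^sup>2 * (\<alpha>\<^sup>2 * (\<Sum>i = 1..n. \<Sum>j = 1..n. inner (d i \<omega>) (d j \<omega>) *
          inner (T \<omega> (d i \<omega>)) (T \<omega> (d j \<omega>))))"
      by (simp add: b_def sum_distrib_left power2_eq_square mult_ac)
    also have "(norm (T \<omega> (a \<omega>)))\<^sup>2 + \<dots> \<le> (norm (a \<omega>))\<^sup>2 + 2 * \<gamma>\<^sup>2 * real n"
      using norm_le_reg_op[OF \<alpha>, of "T \<omega> (a \<omega>)" "\<lambda>i. d i \<omega>" n]
      by (intro add_mono mult_left_mono gram_trace_bound[OF \<alpha>] power_mono) (simp_all add: T)
    finally show ?thesis
      by (simp add: mult_ac ennreal_leI)
  qed
  have "(\<integral>\<^sup>+\<omega>. ennreal ((norm (e \<omega>))\<^sup>2) \<partial>M) = (\<integral>\<^sup>+\<omega>. \<phi> \<omega> \<omega> \<partial>M)"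
    by (rule nn_integral_cong) (simp add: e \<phi>_def)
  also have "\<dots> = (\<integral>\<^sup>+\<omega>. \<integral>\<^sup>+\<omega>'. \<phi> \<omega> \<omega>' \<partial>M \<partial>M)"
    by (rule nn_integral_decouple[OF indep space \<phi>_meas])
  also have "\<dots> \<le> (\<integral>\<^sup>+\<omega>. ennreal ((norm (a \<omega>))\<^sup>2 + 2 * real n * \<gamma>\<^sup>2) \<partial>M)"
    by (rule nn_integral_mono) (rule inner_bound)
  finally show ?thesis .
qed

section \<open>Time ordering of the sources and the error recursion\<close>

fun source_time :: "source \<Rightarrow> nat" where
  "source_time Signal = 0"
| "source_time (Member k) = 0"
| "source_time (Obs_Noise j) = j"
| "source_time (Ens_Noise j k) = j"

text \<open>The sources that can influence the states at time \<open>j\<close>: initial data count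
  as time 0, and noise with index \<open>j\<close> enters the update producing state
  \<open>j\<close>. The next update therefore uses noise outside this set.\<close>

definition past_sources :: "nat \<Rightarrow> nat \<Rightarrow> source set" where
  "past_sources K j = {s \<in> sources K. source_time s \<le> j}"

lemma scaleR_emp_cov:
  "(1 / \<gamma>\<^sup>2) *\<^sub>R emp_cov K x w =
    (1 / (real K * \<gamma>\<^sup>2)) *\<^sub>R (\<Sum>i = 1..K. inner (x i - ens_mean K x) w *\<^sub>R (x i - ens_mean K x))"
  by (simp add: emp_cov_def outer_def mult.commute)

lemma scaleR_emp_cov_gen:
  "(1 / \<gamma>\<^sup>2) *\<^sub>R emp_cov_gen K x y =
    (1 / (real K * \<gamma>\<^sup>2)) *\<^sub>R (\<Sum>i = 1..K. y (x i - ens_mean K x) *\<^sub>R (x i - ens_mean K x))"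
  by (simp add: emp_cov_gen_def outer_gen_def mult.commute)

text \<open>A discrete Gronwall bound in the extended nonnegative reals, so that no finiteness of
  second moments has to be established first.\<close>

lemma affine_recursion_ennreal:
  fixes E :: "nat \<Rightarrow> ennreal"
  assumes "\<And>j. E (Suc j) \<le> ennreal q * E j + ennreal c" "q \<ge> 0" "c \<ge> 0"
  shows "E j \<le> ennreal (q ^ j) * E 0 + ennreal (c * (\<Sum>i<j. q ^ i))"
proof (induction j)
  case (Suc j)
  have "E (Suc j) \<le> ennreal q * (ennreal (q ^ j) * E 0 + ennreal (c * (\<Sum>i<j. q ^ i))) + ennreal c"
    using assms(1)[of j] Suc.IH by (meson add_right_mono mult_left_mono order_trans zero_le)
  also have "\<dots> = ennreal (q ^ Suc j) * E 0 + (ennreal (q * (c * (\<Sum>i<j. q ^ i))) + ennreal c)"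
    using assms(2,3) by (simp add: distrib_left ennreal_mult sum_nonneg mult.assoc add.assoc)
  also have "ennreal (q * (c * (\<Sum>i<j. q ^ i))) + ennreal c = ennreal (c * (\<Sum>i<Suc j. q ^ i))"
    using assms(2,3) unfolding sum.lessThan_Suc_shift
    by (subst ennreal_plus[symmetric])
      (auto simp: sum_nonneg sum_distrib_left algebra_simps intro!: mult_nonneg_nonneg)
  finally show ?case .
qed simp

theorem theorem4p1:
  fixes emb :: "'v::banach \<Rightarrow> 'h::{real_inner,banach,second_countable_topology}"
    and D :: "'v set" and A :: "'v \<Rightarrow> 'h" and B :: "'v \<Rightarrow> 'v \<Rightarrow> 'h" and f :: "real \<Rightarrow> 'h"
    and lam c R h \<gamma> \<beta> :: real and \<Psi> :: "real \<Rightarrow> 'h \<Rightarrow> 'h" and \<Lambda> :: "'h set"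
    and K :: nat
    and M :: "'w measure" and m0 :: 'h and C0 :: "'h \<Rightarrow> 'h"
    and u :: "nat \<Rightarrow> 'w \<Rightarrow> 'h" and v :: "nat \<Rightarrow> nat \<Rightarrow> 'w \<Rightarrow> 'h"
    and \<xi> y :: "nat \<Rightarrow> 'w \<Rightarrow> 'h \<Rightarrow> real"
    and \<eta> z :: "nat \<Rightarrow> nat \<Rightarrow> 'w \<Rightarrow> 'h \<Rightarrow> real"
  assumes dynamics: "dissipative_dynamics emb D A B f lam c R \<Psi> \<Lambda>"
    and h: "h > 0" and \<gamma>: "\<gamma> > 0" and K: "K \<ge> 1"
    and lipschitz: "\<And>t x w. t > 0 \<Longrightarrow> x \<in> \<Lambda> \<Longrightarrow>
          norm (\<Psi> t x - \<Psi> t w) \<le> exp (\<beta> * t) * norm (x - w)"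
    and prob: "prob_space M"
    and signal_init: "gaussian_rv M m0 C0 (u 0)"
    and ensemble_init: "\<And>k. k \<in> {1..K} \<Longrightarrow> gaussian_rv M m0 C0 (v 0 k)"
    and obs_noise: "\<And>j. j \<ge> 1 \<Longrightarrow> white_noise M (\<xi> j)"
    and ens_noise: "\<And>j k. j \<ge> 1 \<Longrightarrow> k \<in> {1..K} \<Longrightarrow> white_noise M (\<eta> j k)"
    and independent: "prob_space.indep_sets M (source_events M (u 0) (v 0) \<xi> \<eta>) (sources K)"
    and signal: "\<And>j \<omega>. \<omega> \<in> space M \<Longrightarrow> u (Suc j) \<omega> = \<Psi> h (u j \<omega>)"
    and lipschitz_signal: "AE \<omega> in M. \<forall>j w.
          norm (\<Psi> h (u j \<omega>) - \<Psi> h w) \<le> exp (\<beta> * h) * norm (u j \<omega> - w)"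
    and observation: "\<And>j \<omega> d. \<omega> \<in> space M \<Longrightarrow>
          y (Suc j) \<omega> d = inner d (u (Suc j) \<omega>) + \<gamma> * \<xi> (Suc j) \<omega> d"
    and perturbed: "\<And>j k \<omega> d. \<omega> \<in> space M \<Longrightarrow> k \<in> {1..K} \<Longrightarrow>
          z (Suc j) k \<omega> d = y (Suc j) \<omega> d + \<gamma> * \<eta> (Suc j) k \<omega> d"
    and analysis: "\<And>j k \<omega>. \<omega> \<in> space M \<Longrightarrow> k \<in> {1..K} \<Longrightarrow>
          v (Suc j) k \<omega> + (1 / \<gamma>\<^sup>2) *\<^sub>R emp_cov K (\<lambda>i. \<Psi> h (v j i \<omega>)) (v (Suc j) k \<omega>) =
          \<Psi> h (v j k \<omega>) + (1 / \<gamma>\<^sup>2) *\<^sub>R emp_cov_gen K (\<lambda>i. \<Psi> h (v j i \<omega>)) (z (Suc j) k \<omega>)"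
  shows "\<forall>j\<ge>1. \<forall>k\<in>{1..K}.
          (\<integral>\<^sup>+ \<omega>. ennreal ((norm (v j k \<omega> - u j \<omega>))\<^sup>2) \<partial>M) \<le>
            ennreal (exp (2 * \<beta> * h * real j)) *
              (\<integral>\<^sup>+ \<omega>. ennreal ((norm (v 0 k \<omega> - u 0 \<omega>))\<^sup>2) \<partial>M) +
            ennreal (2 * real K * \<gamma>\<^sup>2 *
              (if \<beta> = 0 then real j
               else (exp (2 * \<beta> * h * real j) - 1) / (exp (2 * \<beta> * h) - 1)))"
proof -
  interpret prob_space M by (rule prob)
  interpret dissipative_dynamics emb D A B f lam c R \<Psi> \<Lambda> by (rule dynamics)
  define \<alpha> where "\<alpha> = 1 / (real K * \<gamma>\<^sup>2)"
  have \<alpha>: "\<alpha> \<ge> 0"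
    by (simp add: \<alpha>_def)
  define \<F> where "\<F> J = source_algebra M (u 0) (v 0) \<xi> \<eta> J" for J
  have space\<F>: "space (\<F> J) = space M" for J
    by (simp add: \<F>_def)
  define p where "p j k \<omega> = \<Psi> h (v j k \<omega>)" for j k \<omega>
  define d where "d j k \<omega> = p j k \<omega> - ens_mean K (\<lambda>i. p j i \<omega>)" for j k \<omega>
  have \<Psi>h: "\<Psi> h \<in> borel_measurable borel"
    using h by (intro \<Psi>_measurable) simp

  have analysis': "reg_op \<alpha> (\<lambda>i. d j i \<omega>) K (v (Suc j) k \<omega>) =
      p j k \<omega> + \<alpha> *\<^sub>R (\<Sum>i = 1..K. z (Suc j) k \<omega> (d j i \<omega>) *\<^sub>R d j i \<omega>)"
    if "\<omega> \<in> space M" "k \<in> {1..K}" for j k \<omega>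
    using analysis[OF that, of j] unfolding scaleR_emp_cov scaleR_emp_cov_gen
    by (simp add: reg_op_def \<alpha>_def d_def p_def)
  \<comment> \<open>The data split into the signal, which cancels in the error equation, and the two
    noises.\<close>
  have z: "z (Suc j) k \<omega> x = inner x (u (Suc j) \<omega>) + \<gamma> * (\<xi> (Suc j) \<omega> x + \<eta> (Suc j) k \<omega> x)"
    if "\<omega> \<in> space M" "k \<in> {1..K}" for j k \<omega> x
    using that by (simp add: perturbed observation distrib_left)

  have \<xi>_sub: "sets (noise_algebra M (\<xi> j)) \<subseteq> sets (\<F> J)" if "Obs_Noise j \<in> J" for j J
    using source_events_subset[OF that, of M "u 0" "v 0" \<xi> \<eta>] by (simp add: \<F>_def source_events_def)
  have \<eta>_sub: "sets (noise_algebra M (\<eta> j k)) \<subseteq> sets (\<F> J)" if "Ens_Noise j k \<in> J" for j k J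
    using source_events_subset[OF that, of M "u 0" "v 0" \<xi> \<eta>] by (simp add: \<F>_def source_events_def)
  have past_mono: "x \<in> borel_measurable (\<F> (past_sources K (Suc j)))"
    if "x \<in> borel_measurable (\<F> (past_sources K j))" for x :: "'w \<Rightarrow> 'h" and j
  proof -
    have "sets (\<F> (past_sources K j)) \<subseteq> sets (\<F> (past_sources K (Suc j)))"
      unfolding \<F>_def by (rule source_algebra_mono) (auto simp: past_sources_def)
    then have "subalgebra (\<F> (past_sources K (Suc j))) (\<F> (past_sources K j))"
      by (simp add: subalgebra_def space\<F>)
    from measurable_from_subalg[OF this that] show ?thesis .
  qed

  \<comment> \<open>Adaptedness: the states at time \<open>j\<close> are functions of the sources up
    to time \<open>j\<close>.\<close>
  have meas: "u j \<in> borel_measurable (\<F> (past_sources K j)) \<and>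
      (\<forall>k\<in>{1..K}. v j k \<in> borel_measurable (\<F> (past_sources K j)))" for j
  proof (induction j)
    case 0
    have init: "x \<in> borel_measurable (\<F> (past_sources K 0))"
      if "sets (vimage_algebra (space M) x borel) \<subseteq> sets (\<F> (past_sources K 0))" for x :: "'w \<Rightarrow> 'h"
    proof (rule measurableI)
      fix S :: "'h set" assume "S \<in> sets borel"
      then have "x -` S \<inter> space M \<in> sets (vimage_algebra (space M) x borel)"
        by (rule in_vimage_algebra)
      with that show "x -` S \<inter> space (\<F> (past_sources K 0)) \<in> sets (\<F> (past_sources K 0))"
        by (auto simp: space\<F>)
    qed simp
    have "Signal \<in> past_sources K 0"
      by (simp add: past_sources_def sources_def)
    then have "u 0 \<in> borel_measurable (\<F> (past_sources K 0))"
      using source_events_subset[of Signal _ M "u 0" "v 0" \<xi> \<eta>]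
      by (intro init) (simp add: \<F>_def source_events_def)
    moreover have "v 0 k \<in> borel_measurable (\<F> (past_sources K 0))" if "k \<in> {1..K}" for k
    proof -
      have "Member k \<in> past_sources K 0"
        using that by (simp add: past_sources_def sources_def)
      then show ?thesis
        using source_events_subset[of "Member k" _ M "u 0" "v 0" \<xi> \<eta>]
        by (intro init) (simp add: \<F>_def source_events_def)
    qed
    ultimately show ?case by blast
  next
    case (Suc j)
    let ?N = "\<F> (past_sources K (Suc j))"
    have "u j \<in> borel_measurable ?N"
      using Suc.IH past_mono by blast
    from measurable_compose[OF this \<Psi>h] have u_meas: "u (Suc j) \<in> borel_measurable ?N"
      by (rule measurable_cong[THEN iffD1, rotated]) (simp add: space\<F> signal)
    have p_meas: "p j i \<in> borel_measurable ?N" if "i \<in> {1..K}" for i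
      unfolding p_def using Suc.IH that past_mono by (intro measurable_compose[OF _ \<Psi>h]) blast
    have d_meas: "d j i \<in> borel_measurable ?N" if "i \<in> {1..K}" for i
      unfolding d_def ens_mean_def
      by (intro borel_measurable_diff borel_measurable_scaleR borel_measurable_const
          borel_measurable_sum p_meas that)
    have "v (Suc j) k \<in> borel_measurable ?N" if k: "k \<in> {1..K}" for k
    proof -
      \<comment> \<open>The right side of the analysis equation with the data unfolded. The new
        member is given only implicitly; injectivity equates it with \<open>reg_inv\<close> applied
        to \<open>r\<close>, which is visibly measurable.\<close>
      define r where "r \<omega> = p j k \<omega> + \<alpha> *\<^sub>R (\<Sum>i = 1..K. (inner (d j i \<omega>) (u (Suc j) \<omega>) +
        \<gamma> * (\<xi> (Suc j) \<omega> (d j i \<omega>) + \<eta> (Suc j) k \<omega> (d j i \<omega>))) *\<^sub>R d j i \<omega>)" for \<omega>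
      have noise: "Obs_Noise (Suc j) \<in> past_sources K (Suc j)"
          "Ens_Noise (Suc j) k \<in> past_sources K (Suc j)"
        using k by (auto simp: past_sources_def sources_def)
      have "r \<in> borel_measurable ?N"
        unfolding r_def
        by (intro borel_measurable_add borel_measurable_scaleR borel_measurable_const
            borel_measurable_sum borel_measurable_times borel_measurable_inner p_meas d_meas u_meas k
            measurable_white_noise_eval[OF obs_noise \<xi>_sub[OF noise(1)] space\<F>]
            measurable_white_noise_eval[OF ens_noise \<eta>_sub[OF noise(2)] space\<F>]
            measurable_ident) simp_all
      with d_meas have "(\<lambda>\<omega>. reg_inv \<alpha> (\<lambda>i. d j i \<omega>) K (r \<omega>)) \<in> borel_measurable ?N"
        by (rule borel_measurable_reg_inv)
      moreover have "reg_inv \<alpha> (\<lambda>i. d j i \<omega>) K (r \<omega>) = v (Suc j) k \<omega>" if "\<omega> \<in> space M" for \<omega>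
        by (rule reg_op_inject[OF \<alpha>, of "\<lambda>i. d j i \<omega>" K]) (simp add: reg_op_reg_inv[OF \<alpha>] analysis'[OF that k]
            z[OF that k] r_def)
      ultimately show ?thesis
        by (subst measurable_cong[of _ _ "\<lambda>\<omega>. reg_inv \<alpha> (\<lambda>i. d j i \<omega>) K (r \<omega>)"]) (simp_all add: space\<F>)
    qed
    with u_meas show ?case by blast
  qed

  have step: "(\<integral>\<^sup>+\<omega>. ennreal ((norm (v (Suc j) k \<omega> - u (Suc j) \<omega>))\<^sup>2) \<partial>M) \<le>
      ennreal (exp (2 * \<beta> * h)) * (\<integral>\<^sup>+\<omega>. ennreal ((norm (v j k \<omega> - u j \<omega>))\<^sup>2) \<partial>M) +
      ennreal (2 * real K * \<gamma>\<^sup>2)" if k: "k \<in> {1..K}" for j k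
  proof -
    \<comment> \<open>The two noises of this update have time \<open>Suc j\<close>, hence are
      disjoint from the past; they are also independent of each other, as the covariance of their
      sum requires.\<close>
    let ?P = "past_sources K j" and ?Q = "{Obs_Noise (Suc j), Ens_Noise (Suc j) k}"
    have noise_sources: "?Q \<subseteq> sources K"
      using k by (auto simp: sources_def)
    have indep_step: "indep_set (sets (\<F> ?P)) (sets (\<F> ?Q))"
      unfolding \<F>_def using noise_sources
      by (intro indep_source_algebra[OF independent]) (auto simp: past_sources_def)
    have "indep_set (sets (\<F> {Obs_Noise (Suc j)})) (sets (\<F> {Ens_Noise (Suc j) k}))"
      unfolding \<F>_def using noise_sources by (intro indep_source_algebra[OF independent]) auto
    then have indep_noise:
      "indep_set (sets (noise_algebra M (\<xi> (Suc j)))) (sets (noise_algebra M (\<eta> (Suc j) k)))"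
      using \<xi>_sub[of "Suc j" "{Obs_Noise (Suc j)}"] \<eta>_sub[of "Suc j" k "{Ens_Noise (Suc j) k}"]
      unfolding indep_sets2_eq by blast
    have u_meas: "u j \<in> borel_measurable (\<F> ?P)"
      using meas[of j] by blast
    have v_meas: "v j i \<in> borel_measurable (\<F> ?P)" if "i \<in> {1..K}" for i
      using meas[of j] that by auto
    have p_meas: "p j i \<in> borel_measurable (\<F> ?P)" if "i \<in> {1..K}" for i
      unfolding p_def by (intro measurable_compose[OF _ \<Psi>h] v_meas that)
    have d_meas: "d j i \<in> borel_measurable (\<F> ?P)" if "i \<in> {1..K}" for i
      unfolding d_def ens_mean_def
      by (intro borel_measurable_diff borel_measurable_scaleR borel_measurable_const
          borel_measurable_sum p_meas that)
    have a_meas: "(\<lambda>\<omega>. p j k \<omega> - \<Psi> h (u j \<omega>)) \<in> borel_measurable (\<F> ?P)"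
      by (intro borel_measurable_diff p_meas k measurable_compose[OF u_meas \<Psi>h])
    have error_eq: "reg_op \<alpha> (\<lambda>i. d j i \<omega>) K (v (Suc j) k \<omega> - u (Suc j) \<omega>) =
        (p j k \<omega> - \<Psi> h (u j \<omega>)) + (\<alpha> * \<gamma>) *\<^sub>R
          (\<Sum>i = 1..K. (\<xi> (Suc j) \<omega> (d j i \<omega>) + \<eta> (Suc j) k \<omega> (d j i \<omega>)) *\<^sub>R d j i \<omega>)"
      if "\<omega> \<in> space M" for \<omega>
    proof -
      \<comment> \<open>The operator is applied to both states separately: its rank-one part on the
        signal is precisely the signal's share of the data term, so only noise survives.\<close>
      have "reg_op \<alpha> (\<lambda>i. d j i \<omega>) K (v (Suc j) k \<omega> - u (Suc j) \<omega>) =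
          p j k \<omega> + \<alpha> *\<^sub>R (\<Sum>i = 1..K. z (Suc j) k \<omega> (d j i \<omega>) *\<^sub>R d j i \<omega>) -
          (u (Suc j) \<omega> + \<alpha> *\<^sub>R (\<Sum>i = 1..K. inner (d j i \<omega>) (u (Suc j) \<omega>) *\<^sub>R d j i \<omega>))"
        unfolding linear_diff[OF linear_reg_op] analysis'[OF that k] by (simp add: reg_op_def)
      then show ?thesis
        by (simp add: z[OF that k] that distrib_left scaleR_add_left sum.distrib
            scaleR_sum_right scaleR_add_right signal mult_ac)
    qed
    have sub: "subalgebra M (\<F> ?P)"
      using indep_setD_ev1[OF indep_step] by (simp add: subalgebra_def space\<F>)
    have [measurable]: "u j \<in> borel_measurable M" "v j k \<in> borel_measurable M"
      using measurable_from_subalg[OF sub] u_meas v_meas k by auto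
    have "(\<integral>\<^sup>+\<omega>. ennreal ((norm (v (Suc j) k \<omega> - u (Suc j) \<omega>))\<^sup>2) \<partial>M) \<le>
        (\<integral>\<^sup>+\<omega>. ennreal ((norm (p j k \<omega> - \<Psi> h (u j \<omega>)))\<^sup>2 + 2 * real K * \<gamma>\<^sup>2) \<partial>M)"
      by (rule nn_integral_reg_op_noise_le[OF indep_step space\<F> space\<F> d_meas a_meas
            obs_noise \<xi>_sub ens_noise \<eta>_sub indep_noise \<alpha> error_eq]) (use k in auto)
    also have "\<dots> \<le> (\<integral>\<^sup>+\<omega>. ennreal (exp (2 * \<beta> * h)) * ennreal ((norm (v j k \<omega> - u j \<omega>))\<^sup>2) +
        ennreal (2 * real K * \<gamma>\<^sup>2) \<partial>M)"
    \<comment> \<open>The Lipschitz bound along the signal path holds almost surely, which is enough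
      under the integral; it is used with the ensemble member as second point.\<close>
    proof (rule nn_integral_mono_AE)
      show "AE \<omega> in M. ennreal ((norm (p j k \<omega> - \<Psi> h (u j \<omega>)))\<^sup>2 + 2 * real K * \<gamma>\<^sup>2) \<le>
          ennreal (exp (2 * \<beta> * h)) * ennreal ((norm (v j k \<omega> - u j \<omega>))\<^sup>2) +
          ennreal (2 * real K * \<gamma>\<^sup>2)"
        using lipschitz_signal
      proof eventually_elim
        case (elim \<omega>)
        then have "norm (p j k \<omega> - \<Psi> h (u j \<omega>)) \<le> exp (\<beta> * h) * norm (v j k \<omega> - u j \<omega>)"
          unfolding p_def by (metis norm_minus_commute)
        then have "(norm (p j k \<omega> - \<Psi> h (u j \<omega>)))\<^sup>2 \<le> (exp (\<beta> * h) * norm (v j k \<omega> - u j \<omega>))\<^sup>2"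
          by (intro power_mono) simp_all
        also have "\<dots> = exp (2 * \<beta> * h) * (norm (v j k \<omega> - u j \<omega>))\<^sup>2"
          by (simp add: power_mult_distrib exp_double[symmetric] mult.assoc)
        finally show ?case
          by (simp add: ennreal_mult[symmetric] ennreal_plus[symmetric] ennreal_leI del: ennreal_plus)
      qed
    qed
    also have "\<dots> = ennreal (exp (2 * \<beta> * h)) * (\<integral>\<^sup>+\<omega>. ennreal ((norm (v j k \<omega> - u j \<omega>))\<^sup>2) \<partial>M) +
        ennreal (2 * real K * \<gamma>\<^sup>2)"
      by (simp add: nn_integral_add nn_integral_cmult emeasure_space_1)
    finally show ?thesis .
  qed

  show ?thesis
  proof (intro allI impI ballI)
    fix j k assume k: "k \<in> {1..K}"
    have "exp (2 * \<beta> * h) ^ j = exp (2 * \<beta> * h * real j)"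
      by (simp add: exp_of_nat2_mult)
    \<comment> \<open>Since \<open>h\<close> is positive, the ratio equals 1 exactly when \<beta> =
      0, where the geometric sum degenerates to \<open>j\<close>.\<close>
    moreover have "(\<Sum>i<j. exp (2 * \<beta> * h) ^ i) = (if \<beta> = 0 then real j
        else (exp (2 * \<beta> * h * real j) - 1) / (exp (2 * \<beta> * h) - 1))"
      using h by (simp add: geometric_sum exp_of_nat2_mult)
    ultimately show "(\<integral>\<^sup>+ \<omega>. ennreal ((norm (v j k \<omega> - u j \<omega>))\<^sup>2) \<partial>M) \<le>
        ennreal (exp (2 * \<beta> * h * real j)) *
          (\<integral>\<^sup>+ \<omega>. ennreal ((norm (v 0 k \<omega> - u 0 \<omega>))\<^sup>2) \<partial>M) +
        ennreal (2 * real K * \<gamma>\<^sup>2 * (if \<beta> = 0 then real j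
          else (exp (2 * \<beta> * h * real j) - 1) / (exp (2 * \<beta> * h) - 1)))"
      using affine_recursion_ennreal[of "\<lambda>j. \<integral>\<^sup>+\<omega>. ennreal ((norm (v j k \<omega> - u j \<omega>))\<^sup>2) \<partial>M",
          OF step[OF k], of j]
      by simp
  qed
qed


end
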